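(* Let $k\in\mathbb{N}$ and, for $1\leq j\leq k$, let $T_j$ be a continuous linear operator on a separable Baire metrizable topological vector space $X_j$. Assume that all the operators $T_1,\dots,T_k$ satisfy the Supercyclicity Criterion with the same sequence $\{n_l\}_{l\in\mathbb{Z}_+}$. Then the direct sum $T_1\oplus\dots\oplus T_k$ is cyclic.
   Context: Vector spaces are over $\mathbb{K}$, which is $\mathbb{R}$ or $\mathbb{C}$; topological vector spaces are Hausdorff, not necessarily locally convex. $\mathbb{Z}_+$ is the set of non-negative integers. A topological space is Baire if the intersection of any sequence of dense open subsets is dense. A continuous linear operator $T$ on a separable Baire metrizable topological vector space $X$ satisfies the Supercyclicity Criterion with the strictly increasing sequence $\{n_l\}_{l\in\mathbb{Z}_+}$ of positive integers if there exist a sequence $\{s_l\}_{l\in\mathbb{Z}_+}$ of positive numbers, dense subsets $E$ and $F$ of $X$ and maps $S_l:F\to X$ for $l\in\mathbb{Z}_+$ (arbitrary maps, not assumed linear or continuous) such that $T^{n_l}S_ly\to y$, $s_lT^{n_l}x\to 0$ and $s_l^{-1}S_ly\to 0$ as $l\to\infty$ for any $x\in E$ and $y\in F$. (In the hypothesis, the sequence $\{n_l\}$ is common to all $T_j$, while the numbers $s_l$, sets $E,F$ and maps $S_l$ may depend on $j$.) The direct sum $T_1\oplus\dots\oplus T_k$ acts on $X_1\times\dots\times X_k$ coordinatewise. An operator $T$ on a topological vector space $X$ is cyclic if there is $x\in X$ such that the linear span of $\{T^nx:n\in\mathbb{Z}_+\}$ is dense in $X$. *)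

theory Defs
  imports "HOL-Analysis.Analysis" "HOL-Algebra.Module"
begin

text \<open>
  The scalar field is a subset \<open>K\<close> of the complex numbers, to be instantiated to
  \<open>\<real>\<close> or to \<open>UNIV\<close>.  Vector spaces are modules over it, with explicit carriers, so that
  the members of an indexed family of spaces may be entirely different spaces.
  The \<open>mult\<close> and \<open>one\<close> fields of a module record are irrelevant here.
\<close>

definition scalars :: "complex set \<Rightarrow> complex ring" where
  "scalars K = \<lparr>carrier = K, monoid.mult = (*), one = 1, zero = 0, add = (+)\<rparr>"

locale hausdorff_tvs = module "scalars K" X
  for K :: "complex set" and X :: "(complex, 'a) module" (structure) +
  fixes \<tau> :: "'a topology"
  assumes topspace_eq_carrier: "topspace \<tau> = carrier X"
    and continuous_add: "continuous_map (prod_topology \<tau> \<tau>) \<tau> (\<lambda>(x, y). x \<oplus> y)"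
    and continuous_smult: "continuous_map (prod_topology (top_of_set K) \<tau>) \<tau> (\<lambda>(c, x). c \<odot> x)"
    and hausdorff: "Hausdorff_space \<tau>"

definition baire_space :: "'a topology \<Rightarrow> bool" where
  "baire_space \<tau> \<longleftrightarrow>
     (\<forall>U :: nat \<Rightarrow> 'a set.
        (\<forall>n. openin \<tau> (U n) \<and> \<tau> closure_of U n = topspace \<tau>) \<longrightarrow>
        \<tau> closure_of (\<Inter>n. U n) = topspace \<tau>)"

definition continuous_linear_operator ::
    "complex set \<Rightarrow> (complex, 'a) module \<Rightarrow> 'a topology \<Rightarrow> ('a \<Rightarrow> 'a) \<Rightarrow> bool" where
  "continuous_linear_operator K X \<tau> T \<longleftrightarrow>
     T \<in> carrier X \<rightarrow> carrier X \<and>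
     (\<forall>x \<in> carrier X. \<forall>y \<in> carrier X. T (x \<oplus>\<^bsub>X\<^esub> y) = T x \<oplus>\<^bsub>X\<^esub> T y) \<and>
     (\<forall>c \<in> K. \<forall>x \<in> carrier X. T (c \<odot>\<^bsub>X\<^esub> x) = c \<odot>\<^bsub>X\<^esub> T x) \<and>
     continuous_map \<tau> \<tau> T"

definition supercyclicity_criterion ::
    "(complex, 'a) module \<Rightarrow> 'a topology \<Rightarrow> ('a \<Rightarrow> 'a) \<Rightarrow> (nat \<Rightarrow> nat) \<Rightarrow> bool" where
  "supercyclicity_criterion X \<tau> T n \<longleftrightarrow>
     (\<exists>(s :: nat \<Rightarrow> real) E F (S :: nat \<Rightarrow> 'a \<Rightarrow> 'a).
        (\<forall>l. 0 < s l) \<and>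
        E \<subseteq> carrier X \<and> \<tau> closure_of E = topspace \<tau> \<and>
        F \<subseteq> carrier X \<and> \<tau> closure_of F = topspace \<tau> \<and>
        (\<forall>l. S l \<in> F \<rightarrow> carrier X) \<and>
        (\<forall>y \<in> F. limitin \<tau> (\<lambda>l. (T ^^ n l) (S l y)) y sequentially) \<and>
        (\<forall>x \<in> E. limitin \<tau> (\<lambda>l. complex_of_real (s l) \<odot>\<^bsub>X\<^esub> (T ^^ n l) x) \<zero>\<^bsub>X\<^esub> sequentially) \<and>
        (\<forall>y \<in> F. limitin \<tau> (\<lambda>l. complex_of_real (inverse (s l)) \<odot>\<^bsub>X\<^esub> S l y) \<zero>\<^bsub>X\<^esub> sequentially))"

definition linear_span :: "complex set \<Rightarrow> (complex, 'a) module \<Rightarrow> 'a set \<Rightarrow> 'a set" where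
  "linear_span K X A = (\<lambda>H. submodule H (scalars K) X) hull A"

definition cyclic_operator ::
    "complex set \<Rightarrow> (complex, 'a) module \<Rightarrow> 'a topology \<Rightarrow> ('a \<Rightarrow> 'a) \<Rightarrow> bool" where
  "cyclic_operator K X \<tau> T \<longleftrightarrow>
     (\<exists>x \<in> carrier X. \<tau> closure_of (linear_span K X (range (\<lambda>n. (T ^^ n) x))) = topspace \<tau>)"

definition product_module :: "'i set \<Rightarrow> ('i \<Rightarrow> (complex, 'a) module) \<Rightarrow> (complex, 'i \<Rightarrow> 'a) module" where
  "product_module I X =
     \<lparr>carrier = (\<Pi>\<^sub>E i\<in>I. carrier (X i)),
      monoid.mult = (\<lambda>x y. \<lambda>i\<in>I. x i \<otimes>\<^bsub>X i\<^esub> y i), one = (\<lambda>i\<in>I. \<one>\<^bsub>X i\<^esub>),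
      zero = (\<lambda>i\<in>I. \<zero>\<^bsub>X i\<^esub>), add = (\<lambda>x y. \<lambda>i\<in>I. x i \<oplus>\<^bsub>X i\<^esub> y i),
      smult = (\<lambda>c x. \<lambda>i\<in>I. c \<odot>\<^bsub>X i\<^esub> x i)\<rparr>"

definition direct_sum_operator :: "'i set \<Rightarrow> ('i \<Rightarrow> 'a \<Rightarrow> 'a) \<Rightarrow> ('i \<Rightarrow> 'a) \<Rightarrow> ('i \<Rightarrow> 'a)" where
  "direct_sum_operator I T = (\<lambda>x. \<lambda>i\<in>I. T i (x i))"

end

theory Submission
  imports Defs
begin

text \<open>
  Pass to an infinite set \<open>L\<close> of indices on which the scales \<open>s j l\<close> of the different operators are
  always ordered in the same way.  A finite product of separable metrizable Baire spaces is Baire, so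
  there is a single \<open>x\<close> for which the vectors \<open>(s j l \<odot> T\<^sub>j\<^sup>n\<^sup>l x\<^sub>j)\<^sub>j\<close>, with \<open>l \<in> L\<close>, are dense in the product.
  These vectors need not lie in the span of the orbit, since the scale depends on the coordinate,
  but multiples by one common scale do.  With the smallest scale, and targets that
  vanish in all coordinates but the first, the orbit approximates the whole first factor; modulo this
  factor the second smallest scale gives the second factor, and so on.
\<close>

section \<open>Baire spaces and their finite products\<close>

lemma baire_space_alt:
  "baire_space X \<longleftrightarrow>
     (\<forall>\<U>. countable \<U> \<longrightarrow> (\<forall>U\<in>\<U>. openin X U \<and> X closure_of U = topspace X) \<longrightarrow>
        (\<forall>V. openin X V \<longrightarrow> V \<noteq> {} \<longrightarrow> V \<inter> \<Inter>\<U> \<noteq> {}))" (is "_ = ?rhs")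
proof
  assume X: "baire_space X"
  show ?rhs
  proof (intro allI impI)
    fix \<U> V
    assume \<U>: "countable \<U>" "\<forall>U\<in>\<U>. openin X U \<and> X closure_of U = topspace X"
      and V: "openin X V" "V \<noteq> {}"
    \<comment> \<open>\<open>from_nat_into\<close> enumerates only nonempty sets, so
      \<open>topspace X\<close>, itself dense and open, is added in case \<open>\<U>\<close> is
      empty.\<close>
    define U where "U = from_nat_into (insert (topspace X) \<U>)"
    have range: "range U = insert (topspace X) \<U>"
      unfolding U_def using \<U>(1) by (intro range_from_nat_into) auto
    have "U n \<in> insert (topspace X) \<U>" for n
      using range by blast
    then have "\<forall>n. openin X (U n) \<and> X closure_of U n = topspace X"
      using \<U>(2) by (metis closure_of_topspace insert_iff openin_topspace)
    then have "X closure_of (\<Inter>n. U n) = topspace X"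
      using X unfolding baire_space_def by blast
    then have "V \<inter> (\<Inter>n. U n) \<noteq> {}"
      using V unfolding dense_intersects_open by blast
    then show "V \<inter> \<Inter>\<U> \<noteq> {}"
      using range by auto
  qed
next
  assume X: ?rhs
  show "baire_space X"
    unfolding baire_space_def
  proof (intro allI impI)
    fix U :: "nat \<Rightarrow> 'a set"
    assume U: "\<forall>n. openin X (U n) \<and> X closure_of U n = topspace X"
    show "X closure_of (\<Inter>n. U n) = topspace X"
      unfolding dense_intersects_open
      using X[rule_format, of "range U"] U by (auto simp: Int_commute)
  qed
qed

lemma baire_spaceD:
  assumes "baire_space X" "countable \<U>"
    and "\<And>U. U \<in> \<U> \<Longrightarrow> openin X U" "\<And>U. U \<in> \<U> \<Longrightarrow> X closure_of U = topspace X"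
    and "openin X V" "V \<noteq> {}"
  shows "V \<inter> \<Inter>\<U> \<noteq> {}"
  using assms unfolding baire_space_alt by blast

text \<open>A product over \<open>insert i I\<close> is homeomorphic, not equal, to a binary
  product, so the induction on the number of factors needs this transfer. Preimages under
  \<open>f\<close> of dense open sets are dense, because a nonempty open \<open>W\<close>
  corresponds to the open set of all \<open>y\<close> with \<open>g y \<in> W\<close>.\<close>

lemma homeomorphic_maps_baire_space:
  assumes "homeomorphic_maps X Y f g" "baire_space X"
  shows "baire_space Y"
  unfolding baire_space_alt
proof (intro allI impI)
  fix \<U> V
  assume \<U>: "countable \<U>" "\<forall>U\<in>\<U>. openin Y U \<and> Y closure_of U = topspace Y"
    and V: "openin Y V" "V \<noteq> {}"
  have cf: "continuous_map X Y f" and cg: "continuous_map Y X g"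
    and gf: "\<And>x. x \<in> topspace X \<Longrightarrow> g (f x) = x" and fg: "\<And>y. y \<in> topspace Y \<Longrightarrow> f (g y) = y"
    using assms(1) unfolding homeomorphic_maps_def by auto
  define pre where "pre U = {x \<in> topspace X. f x \<in> U}" for U
  have pre_open: "openin X (pre U)" if "openin Y U" for U
    unfolding pre_def using cf that by (rule openin_continuous_map_preimage)
  have pre_dense: "X closure_of (pre U) = topspace X" if U: "openin Y U" "Y closure_of U = topspace Y" for U
    unfolding dense_intersects_open
  proof (intro allI impI)
    fix W assume W: "openin X W \<and> W \<noteq> {}"
    then obtain w where w: "w \<in> W" "w \<in> topspace X"
      using openin_subset by blast
    have "openin Y {y \<in> topspace Y. g y \<in> W}"
      using cg W by (auto intro: openin_continuous_map_preimage)
    moreover have "f w \<in> {y \<in> topspace Y. g y \<in> W}"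
      using w gf cf by (auto simp: continuous_map_def Pi_iff)
    ultimately obtain y where "y \<in> U" "y \<in> topspace Y" "g y \<in> W"
      using U(2) unfolding dense_intersects_open by blast
    then have "g y \<in> pre U \<inter> W"
      using W openin_subset fg unfolding pre_def by fastforce
    then show "pre U \<inter> W \<noteq> {}" by blast
  qed
  have "pre V \<noteq> {}"
  proof -
    obtain v where v: "v \<in> V" "v \<in> topspace Y"
      using V openin_subset by blast
    then have "g v \<in> topspace X"
      using cg by (auto simp: continuous_map_def Pi_iff)
    then show ?thesis
      using v fg unfolding pre_def by auto
  qed
  then have "pre V \<inter> \<Inter>(pre ` \<U>) \<noteq> {}"
    using assms(2) \<U> V pre_open pre_dense by (intro baire_spaceD) auto
  then obtain x where "x \<in> pre V" "\<forall>U\<in>\<U>. x \<in> pre U" by blast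
  then have "f x \<in> V \<inter> \<Inter>\<U>"
    unfolding pre_def by auto
  then show "V \<inter> \<Inter>\<U> \<noteq> {}" by blast
qed

text \<open>Oxtoby's argument: the sections of a dense open set over a generic point meet every member
  of a countable base of the second factor, hence are again dense and open.\<close>

lemma baire_space_prod_topology:
  assumes X: "baire_space X" and Y: "baire_space Y" "second_countable Y"
  shows "baire_space (prod_topology X Y)"
  unfolding baire_space_alt
proof (intro allI impI)
  fix \<U> V
  assume \<U>: "countable \<U>"
      "\<forall>U\<in>\<U>. openin (prod_topology X Y) U \<and> prod_topology X Y closure_of U = topspace (prod_topology X Y)"
    and V: "openin (prod_topology X Y) V" "V \<noteq> {}"
  obtain A B where AB: "openin X A" "openin Y B" "A \<noteq> {}" "B \<noteq> {}" "A \<times> B \<subseteq> V"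
  proof -
    obtain a b where ab: "(a, b) \<in> V"
      using V(2) by auto
    obtain A B where "openin X A" "openin Y B" "a \<in> A" "b \<in> B" "A \<times> B \<subseteq> V"
      using V(1)[unfolded openin_prod_topology_alt, rule_format, OF ab] by blast
    then show thesis
      using that by blast
  qed
  obtain \<B> where \<B>: "countable \<B>" "\<And>W. W \<in> \<B> \<Longrightarrow> openin Y W"
      "\<And>U x. openin Y U \<Longrightarrow> x \<in> U \<Longrightarrow> \<exists>W\<in>\<B>. x \<in> W \<and> W \<subseteq> U"
    using Y(2) unfolding second_countable_def by metis
  \<comment> \<open>\<open>G U W\<close> consists of the points over which the section of
    \<open>U\<close> meets \<open>W\<close>.\<close>
  define G where "G U W = {x \<in> topspace X. \<exists>y\<in>W. (x, y) \<in> U}" for U :: "('a \<times> 'b) set" and W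
  have G_open: "openin X (G U W)" if U: "openin (prod_topology X Y) U" for U W
  proof (subst openin_subopen, intro ballI)
    fix x assume "x \<in> G U W"
    then obtain y where y: "y \<in> W" "(x, y) \<in> U" unfolding G_def by auto
    obtain C D where CD: "openin X C" "openin Y D" "x \<in> C" "y \<in> D" "C \<times> D \<subseteq> U"
      using U[unfolded openin_prod_topology_alt, rule_format, OF y(2)] by blast
    then have "C \<subseteq> G U W"
      unfolding G_def using y openin_subset by blast
    then show "\<exists>C. openin X C \<and> x \<in> C \<and> C \<subseteq> G U W"
      using CD by blast
  qed
  have G_dense: "X closure_of (G U W) = topspace X" if "U \<in> \<U>" "W \<in> \<B> - {{}}" for U W
    unfolding dense_intersects_open
  proof (intro allI impI)
    fix C assume C: "openin X C \<and> C \<noteq> {}"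
    have "openin (prod_topology X Y) (C \<times> W)" "C \<times> W \<noteq> {}"
      using C that \<B>(2) by (auto simp: openin_prod_Times_iff)
    then have "U \<inter> (C \<times> W) \<noteq> {}"
      using \<U>(2) that(1) unfolding dense_intersects_open by blast
    then obtain x y where "x \<in> C" "y \<in> W" "(x, y) \<in> U" by auto
    moreover have "x \<in> topspace X"
      using C \<open>x \<in> C\<close> openin_subset by blast
    ultimately show "G U W \<inter> C \<noteq> {}"
      unfolding G_def by blast
  qed
  \<comment> \<open>There are only countably many pairs. The empty set must be removed from the
    base, since \<open>G U {}\<close> is empty.\<close>
  have "A \<inter> \<Inter>((\<lambda>(U, W). G U W) ` (\<U> \<times> (\<B> - {{}}))) \<noteq> {}"
  proof (intro baire_spaceD[OF X])
    fix S assume "S \<in> (\<lambda>(U, W). G U W) ` (\<U> \<times> (\<B> - {{}}))"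
    then obtain U W where "S = G U W" "U \<in> \<U>" "W \<in> \<B> - {{}}"
      by auto
    then show "openin X S" "X closure_of S = topspace X"
      using G_open G_dense \<U>(2) by blast+
  qed (use \<U>(1) \<B>(1) AB in auto)
  then obtain x where x: "x \<in> A" "\<And>U W. U \<in> \<U> \<Longrightarrow> W \<in> \<B> \<Longrightarrow> W \<noteq> {} \<Longrightarrow> x \<in> G U W"
    by fastforce
  have xX: "x \<in> topspace X"
    using x(1) AB(1) openin_subset by blast
  \<comment> \<open>The section over the chosen generic \<open>x\<close>; it is dense because it
    meets every nonempty basic set.\<close>
  define sec where "sec U = {y \<in> topspace Y. (x, y) \<in> U}" for U :: "('a \<times> 'b) set"
  have "B \<inter> \<Inter>(sec ` \<U>) \<noteq> {}"
  proof (intro baire_spaceD[OF Y(1)])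
    fix S assume "S \<in> sec ` \<U>"
    then obtain U where U: "U \<in> \<U>" "S = sec U" by blast
    have "continuous_map Y (prod_topology X Y) (\<lambda>y. (x, y))"
      using xX by (auto simp: continuous_map_pairwise o_def)
    then show "openin Y S"
      unfolding U(2) sec_def using U \<U>(2) by (auto intro: openin_continuous_map_preimage)
    show "Y closure_of S = topspace Y"
      unfolding dense_intersects_open
    proof (intro allI impI)
      fix D assume D: "openin Y D \<and> D \<noteq> {}"
      then obtain W where "W \<in> \<B>" "W \<noteq> {}" "W \<subseteq> D"
        using \<B>(3) by blast
      moreover from this have "x \<in> G U W"
        using x(2) U(1) by blast
      ultimately show "S \<inter> D \<noteq> {}"
        using D openin_subset unfolding U(2) sec_def G_def by blast
    qed
  qed (use \<U> AB in auto)
  then obtain y where "y \<in> B" "\<forall>U\<in>\<U>. (x, y) \<in> U"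
    unfolding sec_def by auto
  then show "V \<inter> \<Inter>\<U> \<noteq> {}"
    using x(1) AB(5) by blast
qed

text \<open>Members of a product are \<open>undefined\<close> off the index set. Since
  \<open>i \<notin> I\<close>, restricting to \<open>I\<close> therefore undoes the update at
  \<open>i\<close> exactly.\<close>

lemma homeomorphic_maps_product_topology_insert:
  assumes "i \<notin> I"
  shows "homeomorphic_maps (prod_topology (product_topology X I) (X i)) (product_topology X (insert i I))
           (\<lambda>(f, a). f(i := a)) (\<lambda>f. (restrict f I, f i))"
  unfolding homeomorphic_maps_def
proof (intro conjI ballI)
  let ?P = "prod_topology (product_topology X I) (X i)"
  have snd: "continuous_map ?P (X i) (\<lambda>z. case z of (f, a) \<Rightarrow> (f(i := a)) i)"
    using continuous_map_snd[of "product_topology X I" "X i"] by (rule continuous_map_eq) auto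
  have fst: "continuous_map ?P (X k) (\<lambda>z. case z of (f, a) \<Rightarrow> (f(i := a)) k)" if "k \<in> I" for k
  proof -
    have "continuous_map ?P (X k) ((\<lambda>f. f k) \<circ> fst)"
      using that by (intro continuous_map_compose[OF continuous_map_fst] continuous_map_product_projection)
    moreover have "k \<noteq> i" using that assms by auto
    ultimately show ?thesis by (simp add: o_def case_prod_unfold)
  qed
  show "continuous_map ?P (product_topology X (insert i I)) (\<lambda>(f, a). f(i := a))"
    unfolding continuous_map_componentwise using fst snd
    by (auto simp: extensional_def PiE_iff case_prod_unfold)
  show "continuous_map (product_topology X (insert i I)) ?P (\<lambda>f. (restrict f I, f i))"
    by (auto simp: continuous_map_pairwise o_def continuous_map_componentwise
        intro!: continuous_map_product_projection)
next
  fix z assume "z \<in> topspace (prod_topology (product_topology X I) (X i))"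
  then show "(case case z of (f, a) \<Rightarrow> f(i := a) of f \<Rightarrow> (restrict f I, f i)) = z"
    using assms by (auto simp: PiE_iff extensional_def fun_eq_iff)
next
  fix f assume "f \<in> topspace (product_topology X (insert i I))"
  then show "(case (restrict f I, f i) of (f, a) \<Rightarrow> f(i := a)) = f"
    by (auto simp: PiE_iff extensional_def fun_eq_iff)
qed

lemma baire_space_product_topology:
  assumes "finite I" "\<And>i. i \<in> I \<Longrightarrow> baire_space (X i)" "\<And>i. i \<in> I \<Longrightarrow> second_countable (X i)"
  shows "baire_space (product_topology X I)"
  using assms
proof (induction I rule: finite_induct)
  case empty
  show ?case
    unfolding baire_space_def
  proof (intro allI impI)
    fix U :: "nat \<Rightarrow> ('a \<Rightarrow> 'b) set"
    assume U: "\<forall>n. openin (product_topology X {}) (U n) \<and>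
      product_topology X {} closure_of U n = topspace (product_topology X {})"
    \<comment> \<open>The empty product is a single point, so its only dense open subset is the
      whole space.\<close>
    have "U n = topspace (product_topology X {})" for n
      using U[rule_format, of n] by (auto simp: openin_product_topology_empty)
    then show "product_topology X {} closure_of (\<Inter>n. U n) = topspace (product_topology X {})"
      by (simp only: INF_const UNIV_not_empty if_False closure_of_topspace simp_thms)
  qed
next
  case (insert i I)
  have "baire_space (prod_topology (product_topology X I) (X i))"
    using insert by (intro baire_space_prod_topology) auto
  then show ?case
    by (rule homeomorphic_maps_baire_space[OF homeomorphic_maps_product_topology_insert[OF insert.hyps(2)]])
qed

text \<open>Balls of radius \<open>1/(m+1)\<close> about the points of a countable dense set form a
  base. Countable bases serve twice: in the product theorem and for listing the targets of a
  universal point.\<close>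

lemma separable_metrizable_imp_second_countable:
  assumes "separable_space X" "metrizable_space X"
  shows "second_countable X"
proof -
  obtain M d where "Metric_space M d" and Xeq: "X = Metric_space.mtopology M d"
    using assms(2) unfolding metrizable_space_def by blast
  then interpret Metric_space M d by simp
  obtain C where C: "countable C" "C \<subseteq> M" "mtopology closure_of C = M"
    using assms(1) unfolding separable_space_def Xeq by auto
  define \<B> where "\<B> = (\<lambda>(c, n). mball c (inverse (real (Suc n)))) ` (C \<times> (UNIV :: nat set))"
  show ?thesis
    unfolding second_countable_def
  proof (intro exI conjI allI impI)
    show "countable \<B>"
      unfolding \<B>_def using C(1) by auto
    show "\<forall>V\<in>\<B>. openin X V"
      unfolding \<B>_def Xeq by auto
    fix U x assume U: "openin X U \<and> x \<in> U"
    then obtain e where e: "e > 0" "mball x e \<subseteq> U" and xM: "x \<in> M"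
      unfolding Xeq openin_mtopology by blast
    \<comment> \<open>With half the radius, the ball about a nearby \<open>c\<close> stays within
      the \<open>e\<close>-ball about \<open>x\<close> by the triangle inequality.\<close>
    obtain n where n: "inverse (real (Suc n)) < e / 2"
      using e(1) reals_Archimedean[of "e / 2"] by auto
    have "\<forall>r>0. \<exists>y\<in>C. y \<in> mball x r"
      using xM C(3) unfolding metric_closure_of by blast
    then obtain c where c: "c \<in> C" "c \<in> mball x (inverse (real (Suc n)))"
      by (meson inverse_positive_iff_positive of_nat_0_less_iff zero_less_Suc)
    have cM: "c \<in> M" using c C by blast
    have dist: "d x c < inverse (real (Suc n))" using c by simp
    have "mball c (inverse (real (Suc n))) \<subseteq> mball x e"
      using dist n cM xM triangle[of x c] by (force simp: in_mball)
    then have "x \<in> mball c (inverse (real (Suc n)))" "mball c (inverse (real (Suc n))) \<subseteq> U"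
      using e(2) dist cM xM commute[of x c] by (auto simp: in_mball)
    then show "\<exists>V\<in>\<B>. x \<in> V \<and> V \<subseteq> U"
      unfolding \<B>_def using c(1) by force
  qed
qed

section \<open>Topological vector spaces and product modules\<close>

lemma scalars_simps [simp]:
  "carrier (scalars K) = K" "a \<otimes>\<^bsub>scalars K\<^esub> b = a * b" "\<one>\<^bsub>scalars K\<^esub> = 1"
  by (simp_all add: scalars_def)

lemma product_module_simps [simp]:
  "carrier (product_module I X) = (\<Pi>\<^sub>E i\<in>I. carrier (X i))"
  "\<zero>\<^bsub>product_module I X\<^esub> = (\<lambda>i\<in>I. \<zero>\<^bsub>X i\<^esub>)"
  "x \<oplus>\<^bsub>product_module I X\<^esub> y = (\<lambda>i\<in>I. x i \<oplus>\<^bsub>X i\<^esub> y i)"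
  "c \<odot>\<^bsub>product_module I X\<^esub> x = (\<lambda>i\<in>I. c \<odot>\<^bsub>X i\<^esub> x i)"
  by (simp_all add: product_module_def)

context hausdorff_tvs
begin

lemma limitin_add:
  assumes "limitin \<tau> f a F" "limitin \<tau> g b F"
  shows "limitin \<tau> (\<lambda>l. f l \<oplus> g l) (a \<oplus> b) F"
proof -
  have "limitin (prod_topology \<tau> \<tau>) (\<lambda>l. (f l, g l)) (a, b) F"
    using assms by (simp add: limitin_pairwise o_def)
  from continuous_map_limit[OF continuous_add this] show ?thesis
    by (simp add: o_def)
qed

lemma continuous_map_smult:
  assumes "c \<in> K"
  shows "continuous_map \<tau> \<tau> (\<lambda>x. c \<odot> x)"
proof -
  have "continuous_map \<tau> (prod_topology (top_of_set K) \<tau>) (\<lambda>x. (c, x))"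
    using assms by (simp add: continuous_map_pairwise o_def)
  from continuous_map_compose[OF this continuous_smult] show ?thesis
    by (simp add: o_def)
qed

lemma smult_zero_right:
  assumes "c \<in> K"
  shows "c \<odot> \<zero> = \<zero>"
  using assms smult_r_distr[of c \<zero> \<zero>] by auto

text \<open>Scalar multiplication sends the compact set \<open>[0,1] \<times> {0}\<close> to zero,
  so the tube lemma gives one \<open>V\<close> for all factors at once, without local convexity. The
  factors will be quotients of two scales, which vary with \<open>l\<close>.\<close>

lemma unit_interval_smult_neighbourhood:
  assumes "\<real> \<subseteq> K" "openin \<tau> W" "\<zero> \<in> W"
  obtains V where "openin \<tau> V" "\<zero> \<in> V"
    "\<And>r v. 0 \<le> r \<Longrightarrow> r \<le> 1 \<Longrightarrow> v \<in> V \<Longrightarrow> complex_of_real r \<odot> v \<in> W"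
proof -
  let ?Q = "prod_topology (top_of_set K) \<tau>"
  let ?J = "complex_of_real ` {0..1}"
  define W' where "W' = {z \<in> topspace ?Q. (case z of (c, x) \<Rightarrow> c \<odot> x) \<in> W}"
  have "openin ?Q W'"
    unfolding W'_def using continuous_smult assms(2) by (rule openin_continuous_map_preimage)
  moreover have JK: "?J \<subseteq> K"
    using assms(1) by (auto simp: Reals_def)
  have "compact ?J"
    by (intro compact_continuous_image continuous_intros) auto
  then have "compactin (top_of_set K) ?J"
    using JK by (simp add: compactin_subtopology)
  moreover have "compactin \<tau> {\<zero>}"
    by (simp add: topspace_eq_carrier)
  moreover have "?J \<times> {\<zero>} \<subseteq> W'"
    using JK assms(3) smult_zero_right unfolding W'_def by (auto simp: topspace_eq_carrier)
  ultimately obtain U V where "?J \<subseteq> U" "openin \<tau> V" "{\<zero>} \<subseteq> V" "U \<times> V \<subseteq> W'"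
    by (metis Wallace_theorem_prod_topology)
  then show thesis
    by (intro that[of V]) (fastforce simp: W'_def)+
qed

end

section \<open>From the criterion to transitivity of the rescaled powers\<close>

lemma continuous_linear_operator_funpow:
  assumes "continuous_linear_operator K X \<tau> T"
  shows "continuous_linear_operator K X \<tau> (T ^^ m)"
proof (induction m)
  case 0
  then show ?case
    by (simp add: continuous_linear_operator_def)
next
  case (Suc m)
  have "continuous_map \<tau> \<tau> (T \<circ> T ^^ m)"
    using Suc assms unfolding continuous_linear_operator_def by (blast intro: continuous_map_compose)
  then show ?case
    using Suc assms unfolding continuous_linear_operator_def by (simp add: Pi_iff)
qed

text \<open>A vector of \<open>E\<close> in \<open>U\<close> is perturbed by a small multiple of
  \<open>S l y\<close> with \<open>y \<in> F\<close> in \<open>V\<close>. The conclusion holds for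
  all large \<open>l\<close>, not just for infinitely many; this lets several operators share one
  \<open>l\<close>, taken from any prescribed infinite set.\<close>

lemma supercyclicity_criterion_imp_transitive:
  assumes "hausdorff_tvs K X \<tau>" "\<real> \<subseteq> K" "continuous_linear_operator K X \<tau> T"
    and "supercyclicity_criterion X \<tau> T n"
  obtains s :: "nat \<Rightarrow> real" where "\<And>l. 0 < s l"
    "\<And>U V. openin \<tau> U \<Longrightarrow> U \<noteq> {} \<Longrightarrow> openin \<tau> V \<Longrightarrow> V \<noteq> {} \<Longrightarrow>
       \<forall>\<^sub>F l in sequentially. \<exists>x\<in>U. complex_of_real (s l) \<odot>\<^bsub>X\<^esub> (T ^^ n l) x \<in> V"
proof -
  interpret hausdorff_tvs K X \<tau> by fact
  from assms(4)[unfolded supercyclicity_criterion_def] show thesis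
  proof (elim exE conjE, intro that)
    fix s :: "nat \<Rightarrow> real" and E F S
    assume s: "\<forall>l. 0 < s l"
      and E: "E \<subseteq> carrier X" "\<tau> closure_of E = topspace \<tau>"
      and F: "F \<subseteq> carrier X" "\<tau> closure_of F = topspace \<tau>"
      and S: "\<forall>l. S l \<in> F \<rightarrow> carrier X"
      and TS: "\<forall>y\<in>F. limitin \<tau> (\<lambda>l. (T ^^ n l) (S l y)) y sequentially"
      and sT: "\<forall>x\<in>E. limitin \<tau> (\<lambda>l. complex_of_real (s l) \<odot>\<^bsub>X\<^esub> (T ^^ n l) x) \<zero>\<^bsub>X\<^esub> sequentially"
      and sS: "\<forall>y\<in>F. limitin \<tau> (\<lambda>l. complex_of_real (inverse (s l)) \<odot>\<^bsub>X\<^esub> S l y) \<zero>\<^bsub>X\<^esub> sequentially"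
    show "0 < s l" for l using s by simp
    fix U V assume U: "openin \<tau> U" "U \<noteq> {}" and V: "openin \<tau> V" "V \<noteq> {}"
    obtain u where u: "u \<in> E" "u \<in> U"
      using E(2) U unfolding dense_intersects_open by blast
    obtain y where y: "y \<in> F" "y \<in> V"
      using F(2) V unfolding dense_intersects_open by blast
    have uX: "u \<in> carrier X" and yX: "y \<in> carrier X"
      using u y E F by auto
    \<comment> \<open>The perturbation tends to zero, so \<open>x l\<close> tends to
      \<open>u\<close>. Under the rescaled power the \<open>u\<close> part tends to zero, while the
      scales cancel in the other part and leave \<open>(T ^^ n l) (S l y)\<close>, which tends to
      \<open>y\<close>.\<close>
    define x where "x l = u \<oplus>\<^bsub>X\<^esub> complex_of_real (inverse (s l)) \<odot>\<^bsub>X\<^esub> S l y" for l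
    have Tx: "complex_of_real (s l) \<odot>\<^bsub>X\<^esub> (T ^^ n l) (x l)
        = complex_of_real (s l) \<odot>\<^bsub>X\<^esub> (T ^^ n l) u \<oplus>\<^bsub>X\<^esub> (T ^^ n l) (S l y)" for l
    proof -
      have K: "complex_of_real (s l) \<in> K" "complex_of_real (inverse (s l)) \<in> K"
        using assms(2) by auto
      have SX: "S l y \<in> carrier X"
        using S y by blast
      note lin = continuous_linear_operator_funpow[OF assms(3), of "n l",
          unfolded continuous_linear_operator_def]
      have TX: "(T ^^ n l) v \<in> carrier X" if "v \<in> carrier X" for v
        using lin that by blast
      have "(T ^^ n l) (x l)
          = (T ^^ n l) u \<oplus>\<^bsub>X\<^esub> complex_of_real (inverse (s l)) \<odot>\<^bsub>X\<^esub> (T ^^ n l) (S l y)"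
        unfolding x_def using lin uX SX K smult_closed by simp
      moreover have "complex_of_real (s l) * complex_of_real (inverse (s l)) = 1"
        using s[rule_format, of l] by (simp flip: of_real_mult)
      ultimately show ?thesis
        using K TX uX SX smult_one[of "(T ^^ n l) (S l y)"] by (simp add: smult_r_distr flip: smult_assoc1)
    qed
    have "limitin \<tau> x (u \<oplus>\<^bsub>X\<^esub> \<zero>\<^bsub>X\<^esub>) sequentially"
      unfolding x_def using y(1) uX by (intro limitin_add bspec[OF sS]) (simp_all add: topspace_eq_carrier)
    then have "\<forall>\<^sub>F l in sequentially. x l \<in> U"
      using u(2) U(1) uX by (simp add: limitin_def)
    moreover have "limitin \<tau> (\<lambda>l. complex_of_real (s l) \<odot>\<^bsub>X\<^esub> (T ^^ n l) (x l)) (\<zero>\<^bsub>X\<^esub> \<oplus>\<^bsub>X\<^esub> y) sequentially"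
      unfolding Tx using u(1) y(1) by (intro limitin_add bspec[OF sT] bspec[OF TS])
    then have "\<forall>\<^sub>F l in sequentially. complex_of_real (s l) \<odot>\<^bsub>X\<^esub> (T ^^ n l) (x l) \<in> V"
      using y(2) V(1) yX by (simp add: limitin_def)
    ultimately show "\<forall>\<^sub>F l in sequentially. \<exists>x\<in>U. complex_of_real (s l) \<odot>\<^bsub>X\<^esub> (T ^^ n l) x \<in> V"
      by eventually_elim blast
  qed
qed

section \<open>A point universal for all coordinates simultaneously\<close>

lemma openin_product_topologyE:
  assumes "openin (product_topology X I) S" "f \<in> S"
  obtains U where "\<And>i. i \<in> I \<Longrightarrow> openin (X i) (U i)" "f \<in> Pi\<^sub>E I U" "Pi\<^sub>E I U \<subseteq> S"
proof -
  obtain U where "finite {i \<in> I. U i \<noteq> topspace (X i)} \<and> (\<forall>i\<in>I. openin (X i) (U i)) \<and>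
      f \<in> Pi\<^sub>E I U \<and> Pi\<^sub>E I U \<subseteq> S"
    using bspec[OF iffD1[OF openin_product_topology_alt assms(1)] assms(2)] by (rule exE)
  then show thesis
    by (intro that[of U]) simp_all
qed

text \<open>A Baire category argument in the product. What matters is that one and the same
  \<open>l \<in> L\<close> serves every coordinate.\<close>

lemma jointly_universal_point:
  fixes g :: "'i \<Rightarrow> nat \<Rightarrow> 'a \<Rightarrow> 'b"
  assumes "finite I" "infinite L"
    and X: "\<And>i. i \<in> I \<Longrightarrow> baire_space (X i)" "\<And>i. i \<in> I \<Longrightarrow> second_countable (X i)"
      "\<And>i. i \<in> I \<Longrightarrow> topspace (X i) \<noteq> {}"
    and Y: "\<And>i. i \<in> I \<Longrightarrow> second_countable (Y i)"
    and g: "\<And>i l. i \<in> I \<Longrightarrow> continuous_map (X i) (Y i) (g i l)"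
    and trans: "\<And>i U V. i \<in> I \<Longrightarrow> openin (X i) U \<Longrightarrow> U \<noteq> {} \<Longrightarrow> openin (Y i) V \<Longrightarrow> V \<noteq> {} \<Longrightarrow>
        \<forall>\<^sub>F l in sequentially. \<exists>x\<in>U. g i l x \<in> V"
  obtains x where "x \<in> topspace (product_topology X I)"
    "\<And>V. (\<And>i. i \<in> I \<Longrightarrow> openin (Y i) (V i) \<and> V i \<noteq> {}) \<Longrightarrow> \<exists>l\<in>L. \<forall>i\<in>I. g i l (x i) \<in> V i"
proof -
  have "\<exists>\<B>. countable \<B> \<and> (\<forall>W\<in>\<B>. openin (Y i) W) \<and>
      (\<forall>U x. openin (Y i) U \<and> x \<in> U \<longrightarrow> (\<exists>W\<in>\<B>. x \<in> W \<and> W \<subseteq> U))" if "i \<in> I" for i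
    using Y[OF that] unfolding second_countable_def .
  then obtain \<B> where \<B>: "\<And>i. i \<in> I \<Longrightarrow> countable (\<B> i)"
      "\<And>i W. i \<in> I \<Longrightarrow> W \<in> \<B> i \<Longrightarrow> openin (Y i) W"
      "\<And>i U x. i \<in> I \<Longrightarrow> openin (Y i) U \<Longrightarrow> x \<in> U \<Longrightarrow> \<exists>W\<in>\<B> i. x \<in> W \<and> W \<subseteq> U"
    by metis
  let ?\<V> = "\<Pi>\<^sub>E i\<in>I. \<B> i - {{}}"
  \<comment> \<open>The points that some \<open>l \<in> L\<close> sends into the target box
    \<open>V\<close>. Letting \<open>V\<close> range over boxes of nonempty basic sets leaves
    countably many conditions.\<close>
  define D where "D V = (\<Union>l\<in>L. \<Pi>\<^sub>E i\<in>I. {x \<in> topspace (X i). g i l x \<in> V i})" for V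
  have "baire_space (product_topology X I)"
    using assms(1) X(1,2) by (rule baire_space_product_topology)
  moreover have "countable (D ` ?\<V>)"
    using assms(1) \<B>(1) by (intro countable_image countable_PiE) auto
  moreover have "openin (product_topology X I) (D V)" if "V \<in> ?\<V>" for V
  proof -
    have "openin (X i) {x \<in> topspace (X i). g i l x \<in> V i}" if "i \<in> I" for i l
      using g[OF that] \<B>(2)[OF that] PiE_mem[OF \<open>V \<in> ?\<V>\<close> that]
      by (intro openin_continuous_map_preimage[of _ "Y i"]) auto
    then show ?thesis
      unfolding D_def using assms(1) by (intro openin_Union) (auto simp: openin_PiE)
  qed
  moreover have "product_topology X I closure_of (D V) = topspace (product_topology X I)"
    if V: "V \<in> ?\<V>" for V
    unfolding dense_intersects_open
  proof (intro allI impI)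
    fix T assume T: "openin (product_topology X I) T \<and> T \<noteq> {}"
    then obtain f where "f \<in> T"
      by blast
    obtain U where U: "\<And>i. i \<in> I \<Longrightarrow> openin (X i) (U i)" "f \<in> Pi\<^sub>E I U" "Pi\<^sub>E I U \<subseteq> T"
      using openin_product_topologyE[OF conjunct1[OF T] \<open>f \<in> T\<close>] by blast
    have "\<forall>\<^sub>F l in sequentially. \<exists>x\<in>U i. g i l x \<in> V i" if "i \<in> I" for i
      using U(1)[OF that] PiE_mem[OF U(2) that] PiE_mem[OF V that] \<B>(2)[OF that]
      by (intro trans[OF that]) auto
    then have "\<forall>\<^sub>F l in sequentially. \<forall>i\<in>I. \<exists>x\<in>U i. g i l x \<in> V i"
      using assms(1) by (intro eventually_ball_finite) auto
    then obtain N where N: "\<And>l. N \<le> l \<Longrightarrow> \<forall>i\<in>I. \<exists>x\<in>U i. g i l x \<in> V i"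
      unfolding eventually_sequentially by blast
    \<comment> \<open>Finitely many eventual statements hold together from some \<open>N\<close> on,
      and the infinite set \<open>L\<close> reaches beyond it.\<close>
    obtain l where l: "l \<in> L" "N \<le> l"
      using assms(2) unfolding infinite_nat_iff_unbounded_le by blast
    obtain x where x: "\<And>i. i \<in> I \<Longrightarrow> x i \<in> U i \<and> g i l (x i) \<in> V i"
      using N[OF l(2)] by metis
    have "restrict x I \<in> Pi\<^sub>E I U"
      using x by auto
    moreover have "restrict x I \<in> D V"
      unfolding D_def using l(1) x openin_subset[OF U(1)] by fastforce
    ultimately show "D V \<inter> T \<noteq> {}"
      using U(3) by blast
  qed
  moreover have "topspace (product_topology X I) \<noteq> {}"
    using X(3) by (auto simp: PiE_eq_empty_iff)
  ultimately have "topspace (product_topology X I) \<inter> \<Inter>(D ` ?\<V>) \<noteq> {}"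
    by (intro baire_spaceD) (blast intro: openin_topspace)+
  then obtain x where x: "x \<in> topspace (product_topology X I)" "\<And>V. V \<in> ?\<V> \<Longrightarrow> x \<in> D V"
    by blast
  show thesis
  proof (rule that[OF x(1)])
    fix V assume V: "\<And>i. i \<in> I \<Longrightarrow> openin (Y i) (V i) \<and> V i \<noteq> {}"
    have "\<exists>W\<in>\<B> i. W \<noteq> {} \<and> W \<subseteq> V i" if "i \<in> I" for i
      using V[OF that] \<B>(3)[OF that, of "V i"] by blast
    then obtain W where W: "\<And>i. i \<in> I \<Longrightarrow> W i \<in> \<B> i \<and> W i \<noteq> {} \<and> W i \<subseteq> V i"
      by metis
    then have "x \<in> D (restrict W I)"
      by (intro x(2)) auto
    then obtain l where "l \<in> L" "\<forall>i\<in>I. g i l (x i) \<in> W i"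
      unfolding D_def by (auto simp: PiE_iff)
    then show "\<exists>l\<in>L. \<forall>i\<in>I. g i l (x i) \<in> V i"
      using W by blast
  qed
qed

section \<open>Absorbing the coordinates one after another\<close>

lemma override_closed:
  assumes "finite A" "v \<in> M" "\<And>i. i \<in> A \<Longrightarrow> y i \<in> C i"
    and "\<And>i v a. i \<in> A \<Longrightarrow> v \<in> M \<Longrightarrow> a \<in> C i \<Longrightarrow> v(i := a) \<in> M"
  shows "(\<lambda>i. if i \<in> A then y i else v i) \<in> M"
  using assms
proof (induction A rule: finite_induct)
  case (insert i A)
  have "(\<lambda>i. if i \<in> A then y i else v i) \<in> M"
    by (rule insert.IH) (use insert.prems in auto)
  then have "(\<lambda>i. if i \<in> A then y i else v i)(i := y i) \<in> M"
    by (intro insert.prems(3)) (use insert.prems(2) in auto)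
  moreover have "(\<lambda>i. if i \<in> A then y i else v i)(i := y i) = (\<lambda>k. if k \<in> insert i A then y k else v k)"
    by auto
  ultimately show ?case by simp
qed simp

text \<open>The scale \<open>s j l\<close> times the vector \<open>(z i l)\<^sub>i\<close> is a bounded multiple of \<open>s i l \<odot> z i l\<close> in every
  coordinate \<open>i\<close> whose own scale is at least \<open>s j l\<close>, so it is small there; coordinates with
  smaller scales have already been freed.  Hence the coordinates are absorbed in the order of their scales.\<close>

lemma closed_additive_eq_topspace:
  fixes X :: "'i \<Rightarrow> (complex, 'a) module" and \<tau> :: "'i \<Rightarrow> 'a topology" and s :: "'i \<Rightarrow> nat \<Rightarrow> real"
    and I :: "'i set"
  defines "P \<equiv> product_topology \<tau> I"
  assumes "finite I" and K: "\<real> \<subseteq> K"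
    and tvs: "\<And>i. i \<in> I \<Longrightarrow> hausdorff_tvs K (X i) (\<tau> i)"
    and M: "M \<subseteq> topspace P" "P closure_of M \<subseteq> M" "(\<lambda>i\<in>I. \<zero>\<^bsub>X i\<^esub>) \<in> M"
      "\<And>v w. v \<in> M \<Longrightarrow> w \<in> M \<Longrightarrow> (\<lambda>i\<in>I. v i \<oplus>\<^bsub>X i\<^esub> w i) \<in> M"
    and s: "\<And>i l. i \<in> I \<Longrightarrow> 0 < s i l"
    and "l0 \<in> L"
    and order: "\<And>i j l. i \<in> I \<Longrightarrow> j \<in> I \<Longrightarrow> l \<in> L \<Longrightarrow> s i l \<le> s j l \<longleftrightarrow> s i l0 \<le> s j l0"
    and z: "\<And>i l. i \<in> I \<Longrightarrow> z i l \<in> carrier (X i)"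
    and zM: "\<And>j l. j \<in> I \<Longrightarrow> (\<lambda>i\<in>I. complex_of_real (s j l) \<odot>\<^bsub>X i\<^esub> z i l) \<in> M"
    and dense: "\<And>V. (\<And>i. i \<in> I \<Longrightarrow> openin (\<tau> i) (V i) \<and> V i \<noteq> {}) \<Longrightarrow>
      \<exists>l\<in>L. \<forall>i\<in>I. complex_of_real (s i l) \<odot>\<^bsub>X i\<^esub> z i l \<in> V i"
  shows "M = topspace P"
proof -
  \<comment> \<open>Coordinate \<open>i\<close> is free: \<open>M\<close> is invariant under
    arbitrary changes of it. For the additive set \<open>M\<close> this follows once
    \<open>M\<close> contains the whole \<open>i\<close>-th factor.\<close>
  define good where "good i \<longleftrightarrow> (\<forall>v\<in>M. \<forall>y\<in>carrier (X i). v(i := y) \<in> M)" for i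
  have space: "topspace (\<tau> i) = carrier (X i)" if "i \<in> I" for i
    using tvs[OF that] by (rule hausdorff_tvs.topspace_eq_carrier)
  then have PC: "topspace P = (\<Pi>\<^sub>E i\<in>I. carrier (X i))"
    unfolding P_def by (auto intro!: PiE_cong)
  have all_good: "good i" if "i \<in> I" for i
  proof (rule ccontr)
    assume "\<not> good i"
    define B where "B = {i \<in> I. \<not> good i}"
    have "finite B" "B \<noteq> {}"
      using \<open>finite I\<close> that \<open>\<not> good i\<close> unfolding B_def by auto
    \<comment> \<open>A non-free coordinate of least scale at \<open>l0\<close>; by
      \<open>order\<close> its scale is least among the non-free ones at every
      \<open>l \<in> L\<close>. This minimal counterexample replaces an induction along the
      scales.\<close>
    define j where "j = arg_min_on (\<lambda>i. s i l0) B"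
    have jmin: "s j l0 \<le> s i l0" if "i \<in> B" for i
      unfolding j_def using \<open>finite B\<close> \<open>B \<noteq> {}\<close> that by (rule arg_min_least)
    have "j \<in> B"
      unfolding j_def using \<open>finite B\<close> \<open>B \<noteq> {}\<close> by (rule arg_min_if_finite(1))
    then have j: "j \<in> I" "\<not> good j"
      unfolding B_def by auto
    interpret j: hausdorff_tvs K "X j" "\<tau> j"
      using j(1) by (rule tvs)
    \<comment> \<open>The embedding of the \<open>j\<close>-th factor into the product.\<close>
    define e where "e y = (\<lambda>i\<in>I. if i = j then y else \<zero>\<^bsub>X i\<^esub>)" for y
    have zero: "\<zero>\<^bsub>X i\<^esub> \<in> carrier (X i)" if "i \<in> I" for i
    proof -
      interpret hausdorff_tvs K "X i" "\<tau> i"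
        using that by (rule tvs)
      show ?thesis by simp
    qed
    have e_carrier: "e y \<in> topspace P" if "y \<in> carrier (X j)" for y
      unfolding PC e_def using that zero by auto
    have eM: "e y \<in> M" if y: "y \<in> carrier (X j)" for y
    proof -
      have "\<exists>w\<in>M. w \<in> W" if W: "openin P W" "e y \<in> W" for W
      proof -
        obtain U where U: "\<And>i. i \<in> I \<Longrightarrow> openin (\<tau> i) (U i)" "e y \<in> Pi\<^sub>E I U" "Pi\<^sub>E I U \<subseteq> W"
          using openin_product_topologyE[OF W[unfolded P_def]] by blast
        have "\<exists>V. openin (\<tau> i) V \<and> \<zero>\<^bsub>X i\<^esub> \<in> V \<and>
            (\<forall>r v. 0 \<le> r \<longrightarrow> r \<le> 1 \<longrightarrow> v \<in> V \<longrightarrow> complex_of_real r \<odot>\<^bsub>X i\<^esub> v \<in> U i)"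
          if i: "i \<in> I" "i \<noteq> j" for i
        proof -
          interpret hausdorff_tvs K "X i" "\<tau> i"
            using i(1) by (rule tvs)
          have "\<zero>\<^bsub>X i\<^esub> \<in> U i"
            using PiE_mem[OF U(2) i(1)] i unfolding e_def by simp
          from unit_interval_smult_neighbourhood[OF K U(1)[OF i(1)] this] show ?thesis
            by metis
        qed
        then obtain V where V: "\<And>i. i \<in> I \<Longrightarrow> i \<noteq> j \<Longrightarrow> openin (\<tau> i) (V i) \<and> \<zero>\<^bsub>X i\<^esub> \<in> V i \<and>
            (\<forall>r v. 0 \<le> r \<longrightarrow> r \<le> 1 \<longrightarrow> v \<in> V i \<longrightarrow> complex_of_real r \<odot>\<^bsub>X i\<^esub> v \<in> U i)"
          by metis
        have yU: "y \<in> U j"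
          using PiE_mem[OF U(2) j(1)] j(1) unfolding e_def by simp
        \<comment> \<open>The target box: near \<open>y\<close> in coordinate \<open>j\<close>, and
          elsewhere so near zero that shrinking by any factor in \<open>[0,1]\<close> stays in
          \<open>U i\<close>.\<close>
        have "openin (\<tau> i) ((V(j := U j)) i) \<and> (V(j := U j)) i \<noteq> {}" if "i \<in> I" for i
          using V[OF that] U(1)[OF that] yU by auto
        from dense[OF this] obtain l where l: "l \<in> L"
          "\<And>i. i \<in> I \<Longrightarrow> complex_of_real (s i l) \<odot>\<^bsub>X i\<^esub> z i l \<in> (V(j := U j)) i"
          by metis
        define A where "A = {i \<in> I. good i}"
        let ?u = "\<lambda>i\<in>I. complex_of_real (s j l) \<odot>\<^bsub>X i\<^esub> z i l"
        \<comment> \<open>The vector \<open>?u\<close> with common scale \<open>s j l\<close> lies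
          in \<open>M\<close>. It may be large in free coordinates, whose own scales can be smaller,
          so there it is overwritten by \<open>e y\<close>.\<close>
        define w where "w = (\<lambda>i. if i \<in> A then e y i else ?u i)"
        have "e y i \<in> carrier (X i)" if "i \<in> A" for i
          using e_carrier[OF y] that unfolding PC A_def by auto
        then have "w \<in> M"
          unfolding w_def using \<open>finite I\<close> zM[OF j(1)]
          by (intro override_closed[of A ?u M "e y" "\<lambda>i. carrier (X i)"]) (simp_all add: A_def good_def)
        moreover have "w \<in> Pi\<^sub>E I U"
        proof (rule PiE_I)
          fix i assume i: "i \<in> I"
          consider "i \<in> A" | "i \<notin> A" "i = j" | "i \<notin> A" "i \<noteq> j" by blast
          then show "w i \<in> U i"
          proof cases
            case 1
            then show ?thesis
              using PiE_mem[OF U(2) i] unfolding w_def by simp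
          next
            case 2
            then show ?thesis
              using l(2)[OF i] i unfolding w_def by simp
          next
            case 3
            interpret hausdorff_tvs K "X i" "\<tau> i"
              using i by (rule tvs)
            \<comment> \<open>Here \<open>i\<close> is not free, so minimality of \<open>j\<close>
              makes the quotient \<open>s j l / s i l\<close> at most 1.\<close>
            have "s j l0 \<le> s i l0"
              using 3 i by (intro jmin) (simp add: A_def B_def)
            then have le: "s j l \<le> s i l"
              using order[OF j(1) i l(1)] by simp
            let ?r = "s j l / s i l"
            have r: "0 \<le> ?r" "?r \<le> 1"
              using le s[OF i, of l] s[OF j(1), of l] by (auto simp: field_simps)
            have "complex_of_real (s i l) \<odot>\<^bsub>X i\<^esub> z i l \<in> V i"
              using l(2)[OF i] 3 by simp
            then have "complex_of_real ?r \<odot>\<^bsub>X i\<^esub> (complex_of_real (s i l) \<odot>\<^bsub>X i\<^esub> z i l) \<in> U i"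
              using V[OF i 3(2)] r by blast
            moreover have "complex_of_real a \<in> K" for a
              using K by auto
            then have "complex_of_real ?r \<odot>\<^bsub>X i\<^esub> (complex_of_real (s i l) \<odot>\<^bsub>X i\<^esub> z i l)
                = complex_of_real (?r * s i l) \<odot>\<^bsub>X i\<^esub> z i l"
              using z[OF i] smult_assoc1[of "complex_of_real ?r" "complex_of_real (s i l)" "z i l"]
              by (simp only: scalars_simps of_real_mult)
            moreover have "?r * s i l = s j l"
              using s[OF i, of l] by simp
            ultimately show ?thesis
              using 3 i unfolding w_def by simp
          qed
        next
          fix i assume "i \<notin> I"
          then show "w i = undefined"
            unfolding w_def A_def by simp
        qed
        ultimately show ?thesis
          using U(3) by blast
      qed
      then have "e y \<in> P closure_of M"
        unfolding in_closure_of using e_carrier[OF y] by blast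
      then show ?thesis
        using M(2) by blast
    qed
    have "good j"
      unfolding good_def
    proof (intro ballI)
      fix v y assume v: "v \<in> M" and y: "y \<in> carrier (X j)"
      have vX: "v i \<in> carrier (X i)" if "i \<in> I" for i
        using v M(1) that unfolding PC by auto
      \<comment> \<open>Coordinate \<open>j\<close> of \<open>v\<close> is changed to
        \<open>y\<close> by adding an element of the \<open>j\<close>-th factor, which is now known
        to lie in \<open>M\<close>.\<close>
      have "(\<lambda>i\<in>I. v i \<oplus>\<^bsub>X i\<^esub> e (y \<ominus>\<^bsub>X j\<^esub> v j) i) \<in> M"
        using vX[OF j(1)] y by (intro M(4) v eM) simp
      moreover have "(\<lambda>i\<in>I. v i \<oplus>\<^bsub>X i\<^esub> e (y \<ominus>\<^bsub>X j\<^esub> v j) i) = v(j := y)"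
      proof
        fix i
        consider "i \<notin> I" | "i = j" | "i \<in> I" "i \<noteq> j" by blast
        then show "(\<lambda>i\<in>I. v i \<oplus>\<^bsub>X i\<^esub> e (y \<ominus>\<^bsub>X j\<^esub> v j) i) i = (v(j := y)) i"
        proof cases
          case 1
          have "v \<in> (\<Pi>\<^sub>E i\<in>I. carrier (X i))"
            using v M(1) unfolding PC by (rule subsetD[rotated])
          from PiE_arb[OF this 1] show ?thesis
            using 1 j(1) by auto
        next
          case 2
          have "v j \<oplus>\<^bsub>X j\<^esub> (y \<ominus>\<^bsub>X j\<^esub> v j) = y"
            using vX[OF j(1)] y by (simp add: j.minus_eq j.a_lcomm j.r_neg)
          then show ?thesis
            using 2 j(1) by (simp add: e_def)
        next
          case 3
          interpret hausdorff_tvs K "X i" "\<tau> i"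
            using 3(1) by (rule tvs)
          show ?thesis
            using 3 vX[OF 3(1)] by (simp add: e_def)
        qed
      qed
      ultimately show "v(j := y) \<in> M" by simp
    qed
    then show False
      using j(2) by simp
  qed
  have "v \<in> M" if v: "v \<in> topspace P" for v
  proof -
    \<comment> \<open>With all coordinates free, any \<open>v\<close> arises from the zero vector by
      overwriting.\<close>
    have "(\<lambda>i. if i \<in> I then v i else (\<lambda>i\<in>I. \<zero>\<^bsub>X i\<^esub>) i) \<in> M"
      using \<open>finite I\<close> v all_good M(3) unfolding PC good_def
      by (intro override_closed[of I "\<lambda>i\<in>I. \<zero>\<^bsub>X i\<^esub>" M v "\<lambda>i. carrier (X i)"]) auto
    moreover have "(\<lambda>i. if i \<in> I then v i else (\<lambda>i\<in>I. \<zero>\<^bsub>X i\<^esub>) i) = v"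
      using PiE_arb[OF v[unfolded PC]] by auto
    ultimately show ?thesis by simp
  qed
  then show ?thesis
    using M(1) by blast
qed

section \<open>Addition on the product, linear spans and orbits\<close>

lemma continuous_map_product_add:
  fixes I :: "'i set" and X :: "'i \<Rightarrow> (complex, 'a) module"
  assumes "\<And>i. i \<in> I \<Longrightarrow> hausdorff_tvs K (X i) (\<tau> i)"
  defines "P \<equiv> product_topology \<tau> I"
  shows "continuous_map (prod_topology P P) P (\<lambda>(v, w). \<lambda>i\<in>I. v i \<oplus>\<^bsub>X i\<^esub> w i)"
  unfolding P_def continuous_map_componentwise
proof (intro conjI ballI)
  let ?P = "product_topology \<tau> I"
  fix i assume i: "i \<in> I"
  interpret hausdorff_tvs K "X i" "\<tau> i"
    using i by (rule assms(1))
  have "continuous_map (prod_topology ?P ?P) (prod_topology (\<tau> i) (\<tau> i)) (\<lambda>z. (fst z i, snd z i))"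
    unfolding continuous_map_pairwise o_def fst_conv snd_conv
    using continuous_map_compose[OF continuous_map_fst[of ?P ?P] continuous_map_product_projection[OF i, of \<tau>]]
      continuous_map_compose[OF continuous_map_snd[of ?P ?P] continuous_map_product_projection[OF i, of \<tau>]]
    by (simp add: o_def)
  from continuous_map_compose[OF this continuous_add]
  show "continuous_map (prod_topology ?P ?P) (\<tau> i) (\<lambda>z. (case z of (v, w) \<Rightarrow> \<lambda>i\<in>I. v i \<oplus>\<^bsub>X i\<^esub> w i) i)"
    using i by (simp add: o_def case_prod_unfold)
qed auto

text \<open>The hull is an intersection of submodules, and each of these properties passes to
  intersections.\<close>

lemma linear_span_closed:
  shows linear_span_base: "a \<in> A \<Longrightarrow> a \<in> linear_span K X A"
    and linear_span_zero: "\<zero>\<^bsub>X\<^esub> \<in> linear_span K X A"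
    and linear_span_add: "a \<in> linear_span K X A \<Longrightarrow> b \<in> linear_span K X A \<Longrightarrow> a \<oplus>\<^bsub>X\<^esub> b \<in> linear_span K X A"
    and linear_span_smult: "c \<in> K \<Longrightarrow> a \<in> linear_span K X A \<Longrightarrow> c \<odot>\<^bsub>X\<^esub> a \<in> linear_span K X A"
  unfolding linear_span_def hull_def
  using subgroup.one_closed[of _ "add_monoid X"] subgroup.m_closed[of _ "add_monoid X"]
  by (auto simp: submodule_def submodule_axioms_def)

text \<open>Extensionality matters at \<open>m = 0\<close>, where the left side is \<open>x\<close>
  itself and the right side is \<open>undefined\<close> off \<open>I\<close>.\<close>

lemma direct_sum_operator_funpow:
  assumes "x \<in> extensional I"
  shows "(direct_sum_operator I T ^^ m) x = (\<lambda>i\<in>I. (T i ^^ m) (x i))"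
proof (induction m)
  case 0
  then show ?case
    using assms by (auto simp: extensional_def)
next
  case (Suc m)
  then show ?case
    by (simp only: funpow.simps o_apply) (auto simp: direct_sum_operator_def)
qed

section \<open>Cyclicity of the direct sum\<close>

theorem theorem7p7:
  fixes K :: "complex set"
    and k :: nat
    and X :: "nat \<Rightarrow> (complex, 'a) module"
    and \<tau> :: "nat \<Rightarrow> 'a topology"
    and T :: "nat \<Rightarrow> 'a \<Rightarrow> 'a"
    and n :: "nat \<Rightarrow> nat"
  assumes "K = \<real> \<or> K = UNIV"
    and "1 \<le> k"
    and "\<And>j. j \<in> {1..k} \<Longrightarrow> hausdorff_tvs K (X j) (\<tau> j)"
    and "\<And>j. j \<in> {1..k} \<Longrightarrow> separable_space (\<tau> j)"
    and "\<And>j. j \<in> {1..k} \<Longrightarrow> baire_space (\<tau> j)"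
    and "\<And>j. j \<in> {1..k} \<Longrightarrow> metrizable_space (\<tau> j)"
    and "\<And>j. j \<in> {1..k} \<Longrightarrow> continuous_linear_operator K (X j) (\<tau> j) (T j)"
    and "strict_mono n"
    and "\<And>l. 0 < n l"
    and "\<And>j. j \<in> {1..k} \<Longrightarrow> supercyclicity_criterion (X j) (\<tau> j) (T j) n"
  shows "cyclic_operator K (product_module {1..k} X) (product_topology \<tau> {1..k})
           (direct_sum_operator {1..k} T)"
proof -
  define I where "I = {1..k}"
  define P where "P = product_topology \<tau> I"
  note tvs = assms(3)[folded I_def]
  have K: "\<real> \<subseteq> K"
    using assms(1) by auto
  have "finite I"
    unfolding I_def by simp
  have space: "topspace (\<tau> i) = carrier (X i)" if "i \<in> I" for i
    using tvs[OF that] by (rule hausdorff_tvs.topspace_eq_carrier)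
  then have PC: "topspace P = (\<Pi>\<^sub>E i\<in>I. carrier (X i))"
    unfolding P_def by (auto intro!: PiE_cong)
  have T: "continuous_linear_operator K (X i) (\<tau> i) (T i ^^ m)" if "i \<in> I" for i m
    using that unfolding I_def by (intro continuous_linear_operator_funpow assms(7))
  define scale where "scale i s \<longleftrightarrow> (\<forall>l. 0 < s l) \<and>
      (\<forall>U V. openin (\<tau> i) U \<longrightarrow> U \<noteq> {} \<longrightarrow> openin (\<tau> i) V \<longrightarrow> V \<noteq> {} \<longrightarrow>
        (\<forall>\<^sub>F l in sequentially. \<exists>x\<in>U. complex_of_real (s l) \<odot>\<^bsub>X i\<^esub> (T i ^^ n l) x \<in> V))"
    for i and s :: "nat \<Rightarrow> real"
  have "\<exists>s. scale i s" if "i \<in> I" for i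
  proof -
    have i: "i \<in> {1..k}"
      using that unfolding I_def .
    show ?thesis
      unfolding scale_def
      by (rule supercyclicity_criterion_imp_transitive[OF tvs[OF that] K assms(7)[OF i] assms(10)[OF i]]) blast
  qed
  then obtain s where scale: "\<And>i. i \<in> I \<Longrightarrow> scale i (s i)"
    by metis
  have s: "0 < s i l" if "i \<in> I" for i l
    using scale[OF that] unfolding scale_def by blast
  have trans: "\<forall>\<^sub>F l in sequentially. \<exists>x\<in>U. complex_of_real (s i l) \<odot>\<^bsub>X i\<^esub> (T i ^^ n l) x \<in> V"
    if "i \<in> I" "openin (\<tau> i) U" "U \<noteq> {}" "openin (\<tau> i) V" "V \<noteq> {}" for i U V
    using scale[OF that(1)] that unfolding scale_def by blast
  \<comment> \<open>\<open>R l\<close> records how the scales compare at \<open>l\<close>. A finite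
    \<open>I\<close> admits finitely many such relations, so one of them, that of \<open>l0\<close>,
    recurs for infinitely many \<open>l\<close>.\<close>
  define R where "R l = {(i, j) \<in> I \<times> I. s i l \<le> s j l}" for l
  have "finite (range R)"
    using \<open>finite I\<close> by (intro finite_subset[of "range R" "Pow (I \<times> I)"]) (auto simp: R_def)
  then obtain l0 where L: "infinite {l. R l = R l0}"
    using pigeonhole_infinite[of "UNIV :: nat set" R] by auto
  have order: "s i l \<le> s j l \<longleftrightarrow> s i l0 \<le> s j l0" if "i \<in> I" "j \<in> I" "l \<in> {l. R l = R l0}" for i j l
  proof -
    have "(i, j) \<in> R l \<longleftrightarrow> (i, j) \<in> R l0"
      using that(3) by simp
    then show ?thesis
      using that(1,2) by (simp add: R_def)
  qed
  have sc: "second_countable (\<tau> i)" if "i \<in> I" for i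
    using that assms(4,6) unfolding I_def by (intro separable_metrizable_imp_second_countable)
  have ne: "topspace (\<tau> i) \<noteq> {}" if "i \<in> I" for i
  proof -
    interpret hausdorff_tvs K "X i" "\<tau> i"
      using that by (rule tvs)
    show ?thesis
      using zero_closed unfolding topspace_eq_carrier by blast
  qed
  have cont: "continuous_map (\<tau> i) (\<tau> i) (\<lambda>x. complex_of_real (s i l) \<odot>\<^bsub>X i\<^esub> (T i ^^ n l) x)"
    if "i \<in> I" for i l
  proof -
    interpret hausdorff_tvs K "X i" "\<tau> i"
      using that by (rule tvs)
    have "continuous_map (\<tau> i) (\<tau> i) (T i ^^ n l)"
      using T[OF that] unfolding continuous_linear_operator_def by blast
    moreover have "complex_of_real (s i l) \<in> K"
      using K by auto
    ultimately show ?thesis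
      using continuous_map_compose[OF _ continuous_map_smult] by (fastforce simp: o_def)
  qed
  \<comment> \<open>This \<open>x\<close> will be the cyclic vector. Each coordinate still carries
    its own scale \<open>s i l\<close> here.\<close>
  obtain x where x: "x \<in> topspace P"
    and dense: "\<And>V. (\<And>i. i \<in> I \<Longrightarrow> openin (\<tau> i) (V i) \<and> V i \<noteq> {}) \<Longrightarrow>
      \<exists>l\<in>{l. R l = R l0}. \<forall>i\<in>I. complex_of_real (s i l) \<odot>\<^bsub>X i\<^esub> (T i ^^ n l) (x i) \<in> V i"
    unfolding P_def
    using jointly_universal_point[where X = \<tau> and Y = \<tau>
        and g = "\<lambda>i l x. complex_of_real (s i l) \<odot>\<^bsub>X i\<^esub> (T i ^^ n l) x",
        OF \<open>finite I\<close> L assms(5)[folded I_def] sc ne sc cont trans] by blast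
  let ?H = "linear_span K (product_module I X) (range (\<lambda>m. (direct_sum_operator I T ^^ m) x))"
  have "P closure_of ?H = topspace P"
    unfolding P_def
  \<comment> \<open>The lemma is applied to the closure of the span, with \<open>z i l\<close> equal
    to \<open>(T i ^^ n l) (x i)\<close>.\<close>
  proof (rule closed_additive_eq_topspace[OF \<open>finite I\<close> K tvs _ _ _ _ s _ order _ _ dense])
    \<comment> \<open>The scalar \<open>c\<close> is common to all coordinates, so this is a
      multiple of an orbit vector.\<close>
    have orbit: "(\<lambda>i\<in>I. c \<odot>\<^bsub>X i\<^esub> (T i ^^ m) (x i)) \<in> ?H" if "c \<in> K" for c m
    proof -
      have "(direct_sum_operator I T ^^ m) x = (\<lambda>i\<in>I. (T i ^^ m) (x i))"
        using x unfolding PC by (intro direct_sum_operator_funpow) (simp add: PiE_iff)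
      then have "(\<lambda>i\<in>I. (T i ^^ m) (x i)) \<in> ?H"
        by (metis linear_span_base rangeI)
      from linear_span_smult[OF that this] show ?thesis
        by (simp cong: restrict_cong)
    qed
    have TX: "(T i ^^ m) (x i) \<in> carrier (X i)" if "i \<in> I" for i m
      using T[OF that, of m] x that unfolding PC continuous_linear_operator_def by blast
    then show "\<And>i l. i \<in> I \<Longrightarrow> (T i ^^ n l) (x i) \<in> carrier (X i)" .
    \<comment> \<open>\<open>closure_of\<close> keeps only points of the topspace, and the span has
      not been shown to lie in it, so membership is checked for each vector used.\<close>
    have sub: "a \<in> product_topology \<tau> I closure_of ?H" if "a \<in> ?H" "a \<in> topspace P" for a
      using that unfolding P_def in_closure_of by blast
    show "(\<lambda>i\<in>I. \<zero>\<^bsub>X i\<^esub>) \<in> product_topology \<tau> I closure_of ?H"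
    proof (rule sub)
      show "(\<lambda>i\<in>I. \<zero>\<^bsub>X i\<^esub>) \<in> ?H"
        using linear_span_zero[where X = "product_module I X"] by simp
      show "(\<lambda>i\<in>I. \<zero>\<^bsub>X i\<^esub>) \<in> topspace P"
        unfolding PC using tvs
        by (auto simp: hausdorff_tvs_def module_def abelian_group_def intro: abelian_monoid.zero_closed)
    qed
    fix j l assume j: "j \<in> I"
    show "(\<lambda>i\<in>I. complex_of_real (s j l) \<odot>\<^bsub>X i\<^esub> (T i ^^ n l) (x i)) \<in> product_topology \<tau> I closure_of ?H"
    proof (rule sub)
      have sK: "complex_of_real (s j l) \<in> K"
        using K by auto
      then show "(\<lambda>i\<in>I. complex_of_real (s j l) \<odot>\<^bsub>X i\<^esub> (T i ^^ n l) (x i)) \<in> ?H"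
        by (rule orbit)
      have "complex_of_real (s j l) \<odot>\<^bsub>X i\<^esub> (T i ^^ n l) (x i) \<in> carrier (X i)" if "i \<in> I" for i
      proof -
        interpret hausdorff_tvs K "X i" "\<tau> i"
          using that by (rule tvs)
        show ?thesis
          using sK TX[OF that] by simp
      qed
      then show "(\<lambda>i\<in>I. complex_of_real (s j l) \<odot>\<^bsub>X i\<^esub> (T i ^^ n l) (x i)) \<in> topspace P"
        unfolding PC by auto
    qed
  next
    let ?M = "product_topology \<tau> I closure_of ?H"
    fix v w assume v: "v \<in> ?M" and w: "w \<in> ?M"
    let ?add = "\<lambda>(v, w). \<lambda>i\<in>I. v i \<oplus>\<^bsub>X i\<^esub> w i"
    \<comment> \<open>Continuity of addition carries the closure of \<open>?H \<times> ?H\<close>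
      into the closure of its image, and that image lies in \<open>?H\<close>.\<close>
    have "?add (v, w) \<in> ?add ` (prod_topology (product_topology \<tau> I) (product_topology \<tau> I) closure_of (?H \<times> ?H))"
      unfolding closure_of_Times using v w by blast
    also have "\<dots> \<subseteq> product_topology \<tau> I closure_of (?add ` (?H \<times> ?H))"
      by (intro continuous_map_image_closure_subset continuous_map_product_add[OF tvs])
    also have "\<dots> \<subseteq> ?M"
      using linear_span_add[where X = "product_module I X"] by (intro closure_of_mono) fastforce
    finally show "(\<lambda>i\<in>I. v i \<oplus>\<^bsub>X i\<^esub> w i) \<in> ?M"
      by simp
  qed (simp_all add: closure_of_subset_topspace del: topspace_product_topology)
  then show ?thesis
    unfolding cyclic_operator_def using x PC unfolding P_def I_def[symmetric]
    by (intro bexI[of _ x]) (simp_all only: product_module_simps)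
qed

end
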